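(* Let $n$ be a positive integer and let $b=\lfloor\log_2 n\rfloor+2$. Then expanding $(1+x_1)^n\in\mathcal{K}_b/(2)$ and evaluating the result in $\mathbb{Z}$ at $x_1=x_2=\cdots=x_b=1$ yields the $n$th term of Gould's sequence, $\mathcal{G}_n=2^{\#(n)}$, where $\#(n)$ is the Hamming weight of $n$ (the number of $1$s in the binary expansion of $n$).
   Context: For positive integers $N$ and $m$, let $\mathcal{K}_N/(m)=(\mathbb{Z}/m\mathbb{Z})[x_1,\ldots,x_N]/I$ with $I=\langle x_1^2-P_1,\ldots,x_N^2-P_N\rangle$, where $P_i=2x_i+x_{i+1}$ for $1\le i<N$ and $P_N=0$, with coefficients taken modulo $m$. Here $m=2$. The expansion of an element of $\mathcal{K}_N/(2)$ is its fully reduced representative: the unique polynomial in $(\mathbb{Z}/2\mathbb{Z})[x_1,\ldots,x_N]$ of degree at most $1$ in each variable $x_i$ that represents it modulo $I$. Evaluating the result in $\mathbb{Z}$ at $x_1=\cdots=x_N=1$ means lifting each coefficient of this representative to $\{0,1\}\subset\mathbb{Z}$ and summing the lifted coefficients in $\mathbb{Z}$. Gould's sequence $\mathcal{G}$ has terms $\mathcal{G}_n=2^{\#(n)}$. *)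

theory Defs
  imports
    Complex_Main
    "HOL-Library.Poly_Mapping"
    "HOL-Library.Z2"
    "HOL-Algebra.QuotRing"
begin

text \<open>
  A monomial is a finitely supported map from variable indices to exponents, and a polynomial is
  a finitely supported map from monomials to coefficients; the arithmetic is the convolution
  arithmetic provided by \<^theory>\<open>HOL-Library.Poly_Mapping\<close>. The coefficient ring \<open>'a\<close> plays the
  role of \<open>\<int>/m\<int>\<close>; for \<open>m = 2\<close> it is the two-element field \<^typ>\<open>bit\<close>.
\<close>

type_synonym 'a mpoly = "(nat \<Rightarrow>\<^sub>0 nat) \<Rightarrow>\<^sub>0 'a"

definition var :: "nat \<Rightarrow> 'a::comm_ring_1 mpoly" where
  "var i = Poly_Mapping.single (Poly_Mapping.single i 1) 1"

text \<open>The ring of polynomials in the variables \<open>x\<^sub>1, \<dots>, x\<^sub>N\<close> only.\<close>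

definition poly_ring :: "nat \<Rightarrow> ('a::comm_ring_1 mpoly) ring" where
  "poly_ring N =
    \<lparr>carrier = {p. \<forall>m \<in> Poly_Mapping.keys p. Poly_Mapping.keys m \<subseteq> {1..N}},
     mult = (*), one = 1, zero = 0, add = (+)\<rparr>"

definition P :: "nat \<Rightarrow> nat \<Rightarrow> 'a::comm_ring_1 mpoly" where
  "P N i = (if i < N then 2 * var i + var (i + 1) else 0)"

definition K_ideal :: "nat \<Rightarrow> ('a::comm_ring_1 mpoly) set" where
  "K_ideal N = Idl\<^bsub>poly_ring N\<^esub> {var i ^ 2 - P N i | i. i \<in> {1..N}}"

definition K_ring :: "nat \<Rightarrow> ('a::comm_ring_1 mpoly set) ring" where
  "K_ring N = poly_ring N Quot K_ideal N"

definition K_class :: "nat \<Rightarrow> 'a::comm_ring_1 mpoly \<Rightarrow> 'a mpoly set" where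
  "K_class N p = K_ideal N +>\<^bsub>poly_ring N\<^esub> p"

definition fully_reduced :: "nat \<Rightarrow> 'a::comm_ring_1 mpoly \<Rightarrow> bool" where
  "fully_reduced N p \<longleftrightarrow>
    (\<forall>m \<in> Poly_Mapping.keys p. \<forall>i \<in> {1..N}. Poly_Mapping.lookup m i \<le> 1)"

definition expansion :: "nat \<Rightarrow> 'a::comm_ring_1 mpoly set \<Rightarrow> 'a mpoly" where
  "expansion N A =
    (THE p. p \<in> carrier (poly_ring N) \<and> fully_reduced N p \<and> K_class N p = A)"

text \<open>
  \<^term>\<open>of_bit :: bit \<Rightarrow> int\<close> lifts \<open>\<int>/2\<int>\<close> to \<open>{0, 1}\<close>; evaluating at \<open>x\<^sub>i = 1\<close> for all \<open>i\<close> sums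
  the lifted coefficients.
\<close>

definition eval_at_ones :: "bit mpoly \<Rightarrow> int" where
  "eval_at_ones p = (\<Sum>m \<in> Poly_Mapping.keys p. of_bit (Poly_Mapping.lookup p m))"

definition hamming_weight :: "nat \<Rightarrow> nat" where
  "hamming_weight n = card {i. bit n i}"

definition gould :: "nat \<Rightarrow> nat" where
  "gould n = 2 ^ hamming_weight n"

end

theory Submission
  imports Defs "HOL-Library.Nat_Bijection" "HOL-Computational_Algebra.Polynomial"
begin

text \<open>
  Modulo \<open>2\<close> the relations read \<open>x\<^sub>i\<^sup>2 = x\<^sub>i\<^sub>+\<^sub>1\<close> for \<open>i < N\<close> and \<open>x\<^sub>N\<^sup>2 = 0\<close>. Squaring is
  additive in characteristic two, so \<open>(1 + x\<^sub>1)\<close> raised to the power \<open>2 ^ i\<close> is \<open>1 + x\<^sub>i\<^sub>+\<^sub>1\<close>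
  as long as \<open>i < N\<close> (lemma \<open>K_class_one_plus_var_power_2\<close>). Writing \<open>n\<close> in binary, with
  \<open>B\<close> the set of positions of its ones, the class of \<open>(1 + x\<^sub>1) ^ n\<close> is the class of the product
  of the factors \<open>1 + x\<^sub>i\<^sub>+\<^sub>1\<close> over \<open>i \<in> B\<close>. Multiplied out, this product is the sum of the
  squarefree monomials attached to the subsets of \<open>B\<close> (lemma \<open>keys_prod_one_plus_var\<close>). It is
  therefore already fully reduced, and it has \<open>2 ^ card B\<close> terms, each with coefficient \<open>1\<close>.

  What remains is that a class has only one fully reduced representative, for otherwise the
  product need not be the expansion. This comes from the substitution of \<open>t\<close> to the power
  \<open>2 ^ (i - 1)\<close> for \<open>x\<^sub>i\<close>, where \<open>t\<close> is a single indeterminate: it sends the generators of the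
  ideal to multiples of \<open>t\<close> to the power \<open>2 ^ N\<close> (lemma \<open>collapse_K_ideal\<close>), while binary
  expansions are unique, so the squarefree monomials in \<open>x\<^sub>1, \<dots>, x\<^sub>N\<close> go to distinct powers of
  \<open>t\<close> below that one (lemmas \<open>inj_on_weight\<close> and \<open>weight_less\<close>). Hence zero is the only fully
  reduced polynomial in the ideal (lemma \<open>reduced_in_K_ideal_eq_0\<close>).
\<close>

section \<open>The polynomial ring and its quotient\<close>

lemma poly_ring_simps [simp]:
  "monoid.mult (poly_ring N) = (*)" "one (poly_ring N) = 1"
  "zero (poly_ring N) = 0" "add (poly_ring N) = (+)"
  by (simp_all add: poly_ring_def)

lemma mem_carrier_poly_ring:
  "p \<in> carrier (poly_ring N) \<longleftrightarrow>
    (\<forall>m \<in> Poly_Mapping.keys p. Poly_Mapping.keys m \<subseteq> {1..N})"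
  by (simp add: poly_ring_def)

lemma one_in_carrier: "1 \<in> carrier (poly_ring N)"
  by (simp add: mem_carrier_poly_ring)

lemma add_in_carrier:
  assumes "p \<in> carrier (poly_ring N)" "q \<in> carrier (poly_ring N)"
  shows "p + q \<in> carrier (poly_ring N)"
  using assms keys_add[of p q] unfolding mem_carrier_poly_ring by blast

lemma uminus_in_carrier:
  "p \<in> carrier (poly_ring N) \<Longrightarrow> - p \<in> carrier (poly_ring N)"
  by (simp add: mem_carrier_poly_ring)

lemma diff_in_carrier:
  assumes "p \<in> carrier (poly_ring N)" "q \<in> carrier (poly_ring N)"
  shows "p - q \<in> carrier (poly_ring N)"
  using add_in_carrier[OF assms(1) uminus_in_carrier[OF assms(2)]] by simp

lemma mult_in_carrier:
  assumes "p \<in> carrier (poly_ring N)" "q \<in> carrier (poly_ring N)"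
  shows "p * q \<in> carrier (poly_ring N)"
  unfolding mem_carrier_poly_ring
proof
  fix m assume "m \<in> Poly_Mapping.keys (p * q)"
  then obtain a b where "m = a + b" "a \<in> Poly_Mapping.keys p" "b \<in> Poly_Mapping.keys q"
    using keys_mult[of p q] by blast
  moreover have "Poly_Mapping.keys (a + b) \<subseteq> Poly_Mapping.keys a \<union> Poly_Mapping.keys b"
    by (rule keys_add)
  ultimately show "Poly_Mapping.keys m \<subseteq> {1..N}"
    using assms unfolding mem_carrier_poly_ring by blast
qed

lemma power_in_carrier:
  "p \<in> carrier (poly_ring N) \<Longrightarrow> p ^ k \<in> carrier (poly_ring N)"
  by (induction k) (simp_all add: one_in_carrier mult_in_carrier)

lemma prod_in_carrier:
  "(\<And>i. i \<in> A \<Longrightarrow> f i \<in> carrier (poly_ring N)) \<Longrightarrow> prod f A \<in> carrier (poly_ring N)"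
  by (induction A rule: infinite_finite_induct) (simp_all add: one_in_carrier mult_in_carrier)

lemma var_in_carrier:
  "i \<in> {1..N} \<Longrightarrow> (var i :: 'a::comm_ring_1 mpoly) \<in> carrier (poly_ring N)"
  by (simp add: mem_carrier_poly_ring var_def)

lemma cring_poly_ring: "cring (poly_ring N :: 'a::comm_ring_1 mpoly ring)"
proof (rule cringI)
  show "abelian_group (poly_ring N :: 'a mpoly ring)"
  proof (rule abelian_groupI)
    fix x :: "'a mpoly" assume "x \<in> carrier (poly_ring N)"
    then show "\<exists>y \<in> carrier (poly_ring N). y \<oplus>\<^bsub>poly_ring N\<^esub> x = \<zero>\<^bsub>poly_ring N\<^esub>"
      by (intro bexI[of _ "- x"]) (simp_all add: uminus_in_carrier)
  qed (auto simp: add_in_carrier algebra_simps mem_carrier_poly_ring[of 0])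
  show "comm_monoid (poly_ring N :: 'a mpoly ring)"
    by (rule comm_monoidI) (auto simp: mult_in_carrier one_in_carrier algebra_simps)
qed (simp add: algebra_simps)

lemma a_inv_poly_ring:
  fixes p :: "'a::comm_ring_1 mpoly"
  assumes "p \<in> carrier (poly_ring N)"
  shows "\<ominus>\<^bsub>poly_ring N\<^esub> p = - p"
proof -
  interpret cring "poly_ring N :: 'a mpoly ring" by (rule cring_poly_ring)
  show ?thesis
    using minus_equality[of "- p" p] assms uminus_in_carrier[OF assms] by simp
qed

lemma minus_poly_ring:
  fixes p q :: "'a::comm_ring_1 mpoly"
  assumes "p \<in> carrier (poly_ring N)" "q \<in> carrier (poly_ring N)"
  shows "p \<ominus>\<^bsub>poly_ring N\<^esub> q = p - q"
  using assms by (simp add: a_minus_def a_inv_poly_ring)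

lemma pow_poly_ring: "p [^]\<^bsub>poly_ring N\<^esub> (k::nat) = (p :: 'a::comm_ring_1 mpoly) ^ k"
  by (induction k) (simp_all add: nat_pow_def mult.commute)

lemma generators_in_carrier:
  "{var i ^ 2 - P N i | i. i \<in> {1..N}} \<subseteq> carrier (poly_ring N :: 'a::comm_ring_1 mpoly ring)"
proof -
  have "(var i ^ 2 - P N i :: 'a mpoly) \<in> carrier (poly_ring N)" if "i \<in> {1..N}" for i
  proof -
    have "(2 * var i + var (i + 1) :: 'a mpoly) \<in> carrier (poly_ring N)" if "i < N"
      using \<open>i \<in> {1..N}\<close> that unfolding mult_2
      by (intro add_in_carrier var_in_carrier) auto
    moreover have "(0 :: 'a mpoly) \<in> carrier (poly_ring N)"
      by (simp add: mem_carrier_poly_ring)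
    ultimately have "(P N i :: 'a mpoly) \<in> carrier (poly_ring N)"
      by (simp add: P_def)
    then show ?thesis
      by (intro diff_in_carrier power_in_carrier var_in_carrier that)
  qed
  then show ?thesis by blast
qed

lemma ideal_K_ideal: "ideal (K_ideal N) (poly_ring N :: 'a::comm_ring_1 mpoly ring)"
  unfolding K_ideal_def
  by (rule ring.genideal_ideal[OF cring.axioms(1)[OF cring_poly_ring] generators_in_carrier])

lemma K_class_eq_iff:
  fixes p q :: "'a::comm_ring_1 mpoly"
  assumes "p \<in> carrier (poly_ring N)" "q \<in> carrier (poly_ring N)"
  shows "K_class N p = K_class N q \<longleftrightarrow> p - q \<in> K_ideal N"
  using ring.quotient_eq_iff_same_a_r_cos[OF cring.axioms(1)[OF cring_poly_ring] ideal_K_ideal assms]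
  by (simp add: K_class_def minus_poly_ring assms)

lemma K_class_ring_hom:
  "K_class N \<in> ring_hom (poly_ring N :: 'a::comm_ring_1 mpoly ring) (K_ring N)"
  using ideal.rcos_ring_hom[OF ideal_K_ideal] by (simp add: K_class_def[abs_def] K_ring_def)

lemma K_class_power:
  fixes p :: "'a::comm_ring_1 mpoly"
  assumes "p \<in> carrier (poly_ring N)"
  shows "K_class N (p ^ k) = K_class N p [^]\<^bsub>K_ring N\<^esub> k"
proof -
  have "ring_hom_ring (poly_ring N :: 'a mpoly ring) (K_ring N) (K_class N)"
    using ideal.rcos_ring_hom_ring[OF ideal_K_ideal]
    by (simp add: K_class_def[abs_def] K_ring_def)
  then interpret ring_hom_ring "poly_ring N :: 'a mpoly ring" "K_ring N" "K_class N" .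
  show ?thesis
    using hom_nat_pow[OF assms, of k] by (simp add: pow_poly_ring)
qed

lemma K_class_mult_cong:
  fixes p q p' q' :: "'a::comm_ring_1 mpoly"
  assumes "p \<in> carrier (poly_ring N)" "q \<in> carrier (poly_ring N)"
    and "p' \<in> carrier (poly_ring N)" "q' \<in> carrier (poly_ring N)"
    and "K_class N p = K_class N p'" "K_class N q = K_class N q'"
  shows "K_class N (p * q) = K_class N (p' * q')"
  using ring_hom_mult[OF K_class_ring_hom assms(1,2)] ring_hom_mult[OF K_class_ring_hom assms(3,4)]
    assms(5,6) by simp

text \<open>
  This lets the factors of a product be replaced by congruent ones without leaving the
  polynomials, so that the type-class product operator suffices.
\<close>

lemma K_class_prod_cong:
  fixes f g :: "'i \<Rightarrow> 'a::comm_ring_1 mpoly"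
  assumes "\<And>i. i \<in> A \<Longrightarrow> f i \<in> carrier (poly_ring N)"
    and "\<And>i. i \<in> A \<Longrightarrow> g i \<in> carrier (poly_ring N)"
    and "\<And>i. i \<in> A \<Longrightarrow> K_class N (f i) = K_class N (g i)"
  shows "K_class N (prod f A) = K_class N (prod g A)"
  using assms
  by (induction A rule: infinite_finite_induct)
    (simp_all add: K_class_mult_cong prod_in_carrier)

section \<open>Substituting powers of one indeterminate\<close>

text \<open>
  The exponent of \<open>t\<close> after substituting \<open>t\<close> to the power \<open>2 ^ (i - 1)\<close> for each \<open>x\<^sub>i\<close>. The
  shift by one makes \<open>x\<^sub>1, \<dots>, x\<^sub>N\<close> correspond to the binary digits \<open>0, \<dots>, N - 1\<close>.
\<close>

definition weight :: "(nat \<Rightarrow>\<^sub>0 nat) \<Rightarrow> nat" where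
  "weight m = (\<Sum>i \<in> Poly_Mapping.keys m. Poly_Mapping.lookup m i * 2 ^ (i - 1))"

text \<open>
  The substitution itself, as a map to univariate polynomials in \<open>t\<close>. For coefficients modulo
  \<open>2\<close>, followed by truncation at \<open>t\<close> to the power \<open>2 ^ N\<close>, it identifies the quotient ring with
  the truncated polynomials.
\<close>

definition collapse :: "'a::comm_ring_1 mpoly \<Rightarrow> 'a poly" where
  "collapse p = (\<Sum>m \<in> Poly_Mapping.keys p. monom (Poly_Mapping.lookup p m) (weight m))"

lemma weight_add: "weight (m + m') = weight m + weight m'"
  unfolding weight_def
  by (rule setsum_keys_plus_distrib) (simp_all add: algebra_simps)

lemma collapse_add: "collapse (p + q) = collapse p + collapse q"
  unfolding collapse_def
  by (rule setsum_keys_plus_distrib) (simp_all add: add_monom)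

lemma collapse_single: "collapse (Poly_Mapping.single m c) = monom c (weight m)"
  by (cases "c = 0") (simp_all add: collapse_def)

lemma collapse_0 [simp]: "collapse 0 = 0"
  by (simp add: collapse_def)

lemma collapse_minus: "collapse (- p) = - collapse p"
  using collapse_add[of p "- p"] by (simp add: eq_neg_iff_add_eq_0 add.commute)

lemma collapse_diff: "collapse (p - q) = collapse p - collapse q"
  using collapse_add[of p "- q"] by (simp add: collapse_minus)

text \<open>
  Bilinear identities such as multiplicativity of the substitution reduce, through this
  principle, to the case of single terms.
\<close>

lemma poly_mapping_additive_induct [case_names zero single add]:
  fixes p :: "'k \<Rightarrow>\<^sub>0 'a::monoid_add"
  assumes "Q 0" "\<And>m c. Q (Poly_Mapping.single m c)" "\<And>p q. Q p \<Longrightarrow> Q q \<Longrightarrow> Q (p + q)"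
  shows "Q p"
proof (induction p rule: update_induct)
  case (update f a b)
  have "Poly_Mapping.update a b f = f + Poly_Mapping.single a b"
    using update(1)
    by (intro poly_mapping_eqI)
      (auto simp: lookup_update lookup_add lookup_single in_keys_iff when_def)
  then show ?case using update assms by simp
qed (rule assms)

lemma collapse_mult: "collapse (p * q) = collapse p * collapse q"
proof (induction p rule: poly_mapping_additive_induct)
  case (single m c)
  show ?case
    by (induction q rule: poly_mapping_additive_induct)
      (simp_all add: mult_single collapse_single weight_add mult_monom distrib_left collapse_add)
qed (simp_all add: distrib_right collapse_add)

lemma collapse_var: "i > 0 \<Longrightarrow> collapse (var i) = monom 1 (2 ^ (i - 1))"
  by (simp add: var_def collapse_single weight_def)

section \<open>Uniqueness of reduced representatives modulo two\<close>

lemma two_eq_zero_mpoly: "(2 :: bit mpoly) = 0"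
proof -
  have "(2 :: bit mpoly) = Poly_Mapping.single 0 2" by (rule single_numeral[symmetric])
  then show ?thesis by (simp only: bit_2_eq_0 single_zero)
qed

text \<open>
  For \<open>i < N\<close> both \<open>x\<^sub>i\<^sup>2\<close> and \<open>P\<^sub>i = x\<^sub>i\<^sub>+\<^sub>1\<close> become \<open>t\<close> to the power \<open>2 ^ i\<close> and the generator
  vanishes; for \<open>i = N\<close> it becomes exactly \<open>t\<close> to the power \<open>2 ^ N\<close>.
\<close>

lemma collapse_generator:
  assumes "i \<in> {1..N}"
  shows "monom 1 (2 ^ N) dvd collapse (var i ^ 2 - P N i :: bit mpoly)"
proof -
  have "collapse (var i ^ 2 :: bit mpoly) = monom 1 (2 ^ i)"
    using assms
    by (simp add: power2_eq_square collapse_mult collapse_var mult_monom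
        flip: mult_2 power_Suc)
  moreover have "collapse (P N i :: bit mpoly) = (if i < N then monom 1 (2 ^ i) else 0)"
    by (simp add: P_def two_eq_zero_mpoly collapse_var)
  ultimately show ?thesis
    using assms by (auto simp: collapse_diff)
qed

text \<open>
  The polynomials whose image is a multiple of \<open>t\<close> to the power \<open>2 ^ N\<close> form an ideal, and it
  contains the generators, so it contains the ideal that they generate.
\<close>

lemma collapse_K_ideal:
  assumes "p \<in> K_ideal N"
  shows "monom 1 (2 ^ N) dvd collapse (p :: bit mpoly)"
proof -
  let ?R = "poly_ring N :: bit mpoly ring"
  let ?J = "{p \<in> carrier ?R. monom 1 (2 ^ N) dvd collapse p}"
  interpret cring ?R by (rule cring_poly_ring)
  have "ideal ?J ?R"
  proof (rule idealI)
    show "ring ?R" by (rule ring_axioms)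
    show "subgroup ?J (add_monoid ?R)"
    proof (rule group.subgroupI)
      show "group (add_monoid ?R)" by (rule a_group)
      show "?J \<noteq> {}" using zero_closed by auto
      show "inv\<^bsub>add_monoid ?R\<^esub> a \<in> ?J" if "a \<in> ?J" for a
        using that a_inv_poly_ring[of a N] by (simp add: a_inv_def uminus_in_carrier collapse_minus)
    qed (auto simp: add_in_carrier collapse_add)
  qed (auto simp: mult_in_carrier collapse_mult)
  moreover have "{var i ^ 2 - P N i | i. i \<in> {1..N}} \<subseteq> ?J"
    using generators_in_carrier[of N, where 'a = bit] collapse_generator[of _ N] by blast
  ultimately show ?thesis
    using assms genideal_minimal unfolding K_ideal_def by blast
qed

lemma weight_squarefree:
  assumes "\<And>i. Poly_Mapping.lookup m i \<le> 1"
  shows "weight m = (\<Sum>i \<in> Poly_Mapping.keys m. 2 ^ (i - 1))"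
  unfolding weight_def
proof (rule sum.cong)
  fix i assume "i \<in> Poly_Mapping.keys m"
  then have "Poly_Mapping.lookup m i = 1"
    using assms[of i] by (simp add: in_keys_iff)
  then show "Poly_Mapping.lookup m i * 2 ^ (i - 1) = 2 ^ (i - 1)" by simp
qed simp

definition squarefree_monomials :: "nat \<Rightarrow> (nat \<Rightarrow>\<^sub>0 nat) set" where
  "squarefree_monomials N =
    {m. Poly_Mapping.keys m \<subseteq> {1..N} \<and> (\<forall>i. Poly_Mapping.lookup m i \<le> 1)}"

lemma reduced_iff_squarefree_monomials:
  "p \<in> carrier (poly_ring N) \<and> fully_reduced N p \<longleftrightarrow>
    Poly_Mapping.keys p \<subseteq> squarefree_monomials N"
proof -
  have "(\<forall>i \<in> {1..N}. Poly_Mapping.lookup m i \<le> 1) \<longleftrightarrow> (\<forall>i. Poly_Mapping.lookup m i \<le> 1)"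
    if "Poly_Mapping.keys m \<subseteq> {1..N}"
    for m :: "nat \<Rightarrow>\<^sub>0 nat"
  proof -
    have "Poly_Mapping.lookup m i \<le> 1" if "i \<notin> {1..N}" for i
    proof -
      have "i \<notin> Poly_Mapping.keys m"
        using that \<open>Poly_Mapping.keys m \<subseteq> {1..N}\<close> by blast
      then show ?thesis by (simp add: in_keys_iff)
    qed
    then show ?thesis by blast
  qed
  then show ?thesis
    unfolding mem_carrier_poly_ring fully_reduced_def squarefree_monomials_def subset_iff by auto
qed

text \<open>
  A squarefree monomial is determined by its set of variables, and its weight is the number whose
  binary digits mark this set. Injectivity and the size bound for weights both follow from this.
\<close>

lemma weight_eq_set_encode:
  assumes "m \<in> squarefree_monomials N"
  shows "weight m = set_encode ((\<lambda>i. i - 1) ` Poly_Mapping.keys m)"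
proof -
  have inj: "inj_on (\<lambda>i::nat. i - 1) (Poly_Mapping.keys m)"
  proof (rule inj_on_subset)
    show "inj_on (\<lambda>i::nat. i - 1) {1..N}" by (auto simp: inj_on_def)
    show "Poly_Mapping.keys m \<subseteq> {1..N}" using assms by (simp add: squarefree_monomials_def)
  qed
  have "weight m = (\<Sum>i \<in> Poly_Mapping.keys m. 2 ^ (i - 1))"
    using assms by (intro weight_squarefree) (simp add: squarefree_monomials_def)
  also have "\<dots> = set_encode ((\<lambda>i. i - 1) ` Poly_Mapping.keys m)"
    unfolding set_encode_def sum.reindex[OF inj] by (simp only: o_def)
  finally show ?thesis .
qed

lemma inj_on_weight: "inj_on weight (squarefree_monomials N)"
proof (rule inj_onI)
  fix m m' assume m: "m \<in> squarefree_monomials N" and m': "m' \<in> squarefree_monomials N"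
    and "weight m = weight m'"
  then have eq: "(\<lambda>i. i - 1) ` Poly_Mapping.keys m = (\<lambda>i. i - 1) ` Poly_Mapping.keys m'"
    by (simp add: weight_eq_set_encode set_encode_eq)
  have "Poly_Mapping.keys k = Suc ` (\<lambda>i. i - 1) ` Poly_Mapping.keys k"
    if "k \<in> squarefree_monomials N" for k
    using that by (force simp: squarefree_monomials_def image_image)
  then have keys: "Poly_Mapping.keys m = Poly_Mapping.keys m'"
    using m m' eq by metis
  show "m = m'"
  proof (rule poly_mapping_eqI)
    fix i
    have "Poly_Mapping.lookup m i \<le> 1" "Poly_Mapping.lookup m' i \<le> 1"
      using m m' by (simp_all add: squarefree_monomials_def)
    moreover have "Poly_Mapping.lookup m i = 0 \<longleftrightarrow> Poly_Mapping.lookup m' i = 0"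
      using keys by (metis in_keys_iff)
    ultimately show "Poly_Mapping.lookup m i = Poly_Mapping.lookup m' i" by linarith
  qed
qed

lemma weight_less:
  assumes "m \<in> squarefree_monomials N"
  shows "weight m < 2 ^ N"
proof -
  have "(\<lambda>i. i - 1) ` Poly_Mapping.keys m \<subseteq> {0..<N}"
    using assms by (force simp: squarefree_monomials_def)
  then have "weight m \<le> (\<Sum>i = 0..<N. 2 ^ i)"
    unfolding weight_eq_set_encode[OF assms] set_encode_def by (intro sum_mono2) auto
  also have "\<dots> < 2 ^ N" by (simp add: sum_power2)
  finally show ?thesis .
qed

text \<open>
  No two squarefree monomials collide under the substitution, so the coefficients of a reduced
  polynomial can be read off its image.
\<close>

lemma coeff_collapse_weight:
  assumes "Poly_Mapping.keys p \<subseteq> squarefree_monomials N" "m \<in> squarefree_monomials N"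
  shows "coeff (collapse p) (weight m) = Poly_Mapping.lookup p m"
proof -
  have "coeff (collapse p) (weight m) =
      (\<Sum>k \<in> Poly_Mapping.keys p. if k = m then Poly_Mapping.lookup p k else 0)"
    unfolding collapse_def coeff_sum
    using assms inj_onD[OF inj_on_weight] by (intro sum.cong) auto
  then show ?thesis by (simp add: in_keys_iff)
qed

lemma reduced_in_K_ideal_eq_0:
  fixes p :: "bit mpoly"
  assumes "Poly_Mapping.keys p \<subseteq> squarefree_monomials N" "p \<in> K_ideal N"
  shows "p = 0"
proof -
  have "Poly_Mapping.keys p = {}"
  proof (rule equals0I)
    fix m assume "m \<in> Poly_Mapping.keys p"
    then have m: "m \<in> squarefree_monomials N" and nonzero: "Poly_Mapping.lookup p m \<noteq> 0"
      using assms(1) unfolding in_keys_iff[symmetric] by blast+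
    have "coeff (collapse p) (weight m) = 0"
      using collapse_K_ideal[OF assms(2)] weight_less[OF m] unfolding monom_1_dvd_iff' by blast
    with nonzero show False using coeff_collapse_weight[OF assms(1) m] by simp
  qed
  then show ?thesis by simp
qed

text \<open>
  Two reduced representatives of a class differ by a reduced polynomial in the ideal, which is
  zero; so the definite description in the expansion is met by any reduced representative.
\<close>

lemma expansion_K_class:
  fixes p :: "bit mpoly"
  assumes "Poly_Mapping.keys p \<subseteq> squarefree_monomials N"
  shows "expansion N (K_class N p) = p"
  unfolding expansion_def
proof (rule the_equality)
  show "p \<in> carrier (poly_ring N) \<and> fully_reduced N p \<and> K_class N p = K_class N p"
    using assms reduced_iff_squarefree_monomials by blast
next
  fix q :: "bit mpoly"
  assume q: "q \<in> carrier (poly_ring N) \<and> fully_reduced N q \<and> K_class N q = K_class N p"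
  then have "Poly_Mapping.keys q \<subseteq> squarefree_monomials N"
    using reduced_iff_squarefree_monomials by blast
  then have "Poly_Mapping.keys (q - p) \<subseteq> squarefree_monomials N"
    using assms keys_diff[of q p] by blast
  moreover have "q - p \<in> K_ideal N"
    using q assms reduced_iff_squarefree_monomials K_class_eq_iff by blast
  ultimately show "q = p"
    using reduced_in_K_ideal_eq_0 by fastforce
qed

section \<open>Expanding the power\<close>

text \<open>
  In characteristic two, \<open>(1 + x\<^sub>i)\<^sup>2 - (1 + x\<^sub>i\<^sub>+\<^sub>1)\<close> is exactly the generator \<open>x\<^sub>i\<^sup>2 - P\<^sub>i\<close>: the
  cross term \<open>2 x\<^sub>i\<close> of the square and the term \<open>2 x\<^sub>i\<close> of \<open>P\<^sub>i\<close> both vanish.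
\<close>

lemma K_class_square_one_plus_var:
  assumes "i \<in> {1..<N}"
  shows "K_class N ((1 + var i) ^ 2 :: bit mpoly) = K_class N (1 + var (i + 1))"
proof (subst K_class_eq_iff)
  have "(var i ^ 2 - P N i :: bit mpoly) \<in> K_ideal N"
    unfolding K_ideal_def
    using ring.genideal_self[OF cring.axioms(1)[OF cring_poly_ring] generators_in_carrier] assms
    by fastforce
  moreover have "(1 + var i) ^ 2 - (1 + var (i + 1)) = (var i ^ 2 - P N i :: bit mpoly)"
    using assms by (simp add: P_def power2_sum two_eq_zero_mpoly)
  ultimately show "(1 + var i) ^ 2 - (1 + var (i + 1)) \<in> (K_ideal N :: bit mpoly set)"
    by simp
qed (use assms in \<open>auto intro!: power_in_carrier add_in_carrier one_in_carrier var_in_carrier\<close>)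

lemma K_class_one_plus_var_power_2:
  assumes "i < N"
  shows "K_class N ((1 + var 1) ^ (2 ^ i) :: bit mpoly) = K_class N (1 + var (i + 1))"
  using assms
proof (induction i)
  case (Suc i)
  have carr: "(1 + var j :: bit mpoly) \<in> carrier (poly_ring N)" if "j \<in> {1..N}" for j
    using that by (intro add_in_carrier one_in_carrier var_in_carrier)
  let ?p = "(1 + var 1) ^ (2 ^ i) :: bit mpoly"
  have "K_class N ((1 + var 1) ^ (2 ^ Suc i) :: bit mpoly) = K_class N (?p ^ 2)"
    by (simp add: power_mult[symmetric] mult.commute)
  also have "\<dots> = K_class N ((1 + var (i + 1)) ^ 2)"
    unfolding power2_eq_square
    using Suc by (intro K_class_mult_cong power_in_carrier carr Suc.IH) auto
  also have "\<dots> = K_class N (1 + var (Suc i + 1))"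
    using K_class_square_one_plus_var[of "i + 1" N] Suc.prems by simp
  finally show ?case .
qed simp

definition subset_monomial :: "nat set \<Rightarrow> (nat \<Rightarrow>\<^sub>0 nat)" where
  "subset_monomial S = (\<Sum>i \<in> S. Poly_Mapping.single (i + 1) 1)"

lemma lookup_subset_monomial:
  "finite S \<Longrightarrow>
    Poly_Mapping.lookup (subset_monomial S) j = (if j \<in> Suc ` S then 1 else 0)"
  by (cases j)
    (auto simp: subset_monomial_def lookup_sum lookup_single when_def)

lemma keys_subset_monomial: "finite S \<Longrightarrow> Poly_Mapping.keys (subset_monomial S) = Suc ` S"
  by (rule Set.set_eqI) (simp add: in_keys_iff lookup_subset_monomial)

lemma inj_on_subset_monomial: "inj_on subset_monomial (Collect finite)"
proof (rule inj_onI)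
  fix S T :: "nat set"
  assume "S \<in> Collect finite" "T \<in> Collect finite" and eq: "subset_monomial S = subset_monomial T"
  then have "Suc ` S = Suc ` T"
    using keys_subset_monomial[of S] keys_subset_monomial[of T] by simp
  then show "S = T" by (simp only: inj_image_eq_iff[OF inj_Suc])
qed

lemma subset_monomial_squarefree:
  assumes "S \<subseteq> {..<N}"
  shows "subset_monomial S \<in> squarefree_monomials N"
proof -
  have "finite S" using assms finite_subset by blast
  moreover have "Suc ` S \<subseteq> {1..N}" using assms by auto
  ultimately show ?thesis
    by (simp add: squarefree_monomials_def keys_subset_monomial lookup_subset_monomial)
qed

lemma prod_var: "(\<Prod>i \<in> S. var (i + 1)) = Poly_Mapping.single (subset_monomial S) 1"
  by (induction S rule: infinite_finite_induct)
    (simp_all add: subset_monomial_def var_def mult_single)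

text \<open>
  Expanding the product gives one monomial for each subset of \<open>B\<close>. Distinct subsets give distinct
  monomials, so no terms merge or cancel, whatever the coefficient ring.
\<close>

lemma keys_prod_one_plus_var:
  assumes "finite B"
  shows "Poly_Mapping.keys (\<Prod>i \<in> B. 1 + var (i + 1) :: 'a::comm_ring_1 mpoly) =
    subset_monomial ` Pow B"
proof -
  have sub: "Pow B \<subseteq> Collect finite" using finite_subset[OF _ assms] by auto
  have "(\<Prod>i \<in> B. 1 + var (i + 1) :: 'a mpoly) = (\<Prod>i \<in> B. var (i + 1) + 1)"
    by (simp add: add.commute)
  also have "\<dots> = (\<Sum>S \<in> Pow B. Poly_Mapping.single (subset_monomial S) 1)"
    using assms by (simp add: prod_add prod_var[simplified])
  finally have eq: "(\<Prod>i \<in> B. 1 + var (i + 1) :: 'a mpoly) = \<dots>" .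
  have lookup: "Poly_Mapping.lookup (\<Prod>i \<in> B. 1 + var (i + 1) :: 'a mpoly) m =
      (if m \<in> subset_monomial ` Pow B then 1 else 0)" for m
  proof -
    have "Poly_Mapping.lookup (\<Prod>i \<in> B. 1 + var (i + 1) :: 'a mpoly) m =
        (\<Sum>k \<in> subset_monomial ` Pow B. if k = m then 1 else 0)"
      using inj_on_subset[OF inj_on_subset_monomial sub]
      unfolding eq by (simp add: lookup_sum lookup_single when_def sum.reindex)
    then show ?thesis using assms by simp
  qed
  show ?thesis
    by (rule Set.set_eqI) (simp only: in_keys_iff lookup, simp)
qed

text \<open>
  The only nonzero coefficient modulo \<open>2\<close> is \<open>1\<close>, so summing the lifted coefficients counts the
  monomials.
\<close>

lemma eval_at_ones_eq_card_keys: "eval_at_ones p = int (card (Poly_Mapping.keys p))"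
proof -
  have "(of_bit (Poly_Mapping.lookup p m) :: int) = 1" if "m \<in> Poly_Mapping.keys p" for m
    using that by (simp add: in_keys_iff)
  then show ?thesis by (simp add: eval_at_ones_def)
qed

lemma set_decode_less:
  assumes "n < 2 ^ N" "i \<in> set_decode n"
  shows "i < N"
proof (rule ccontr)
  assume "\<not> i < N"
  then have "n < 2 ^ i"
    using assms(1) power_increasing[of N i "2::nat"] by linarith
  then show False using assms(2) by (simp add: set_decode_def)
qed

text \<open>
  The bound on \<open>n\<close> keeps all its binary digits at positions \<open>i < N\<close>, where the class of
  \<open>1 + x\<^sub>1\<close> raised to the power \<open>2 ^ i\<close> is that of the linear polynomial \<open>1 + x\<^sub>i\<^sub>+\<^sub>1\<close>.
\<close>

lemma eval_expansion_power:
  assumes "n < 2 ^ N"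
  shows "eval_at_ones (expansion N (K_class N ((1 + var 1) ^ n))) = int (gould n)"
proof -
  let ?B = "set_decode n"
  let ?q = "\<Prod>i \<in> ?B. 1 + var (i + 1) :: bit mpoly"
  have B: "?B \<subseteq> {..<N}" using set_decode_less[OF assms] by blast
  have keys: "Poly_Mapping.keys ?q = subset_monomial ` Pow ?B"
    by (rule keys_prod_one_plus_var) simp
  have "(1 + var 1 :: bit mpoly) ^ n = (1 + var 1) ^ (\<Sum>i \<in> ?B. 2 ^ i)"
    using set_decode_inverse[of n] unfolding set_encode_def by simp
  also have "\<dots> = (\<Prod>i \<in> ?B. (1 + var 1) ^ (2 ^ i))"
    by (rule power_sum)
  finally have "K_class N ((1 + var 1 :: bit mpoly) ^ n) =
      K_class N (\<Prod>i \<in> ?B. (1 + var 1) ^ (2 ^ i))" by simp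
  also have "\<dots> = K_class N ?q"
    using B by (intro K_class_prod_cong K_class_one_plus_var_power_2
        power_in_carrier add_in_carrier one_in_carrier var_in_carrier) auto
  finally have class_eq: "K_class N ((1 + var 1) ^ n) = K_class N ?q" .
  have "Poly_Mapping.keys ?q \<subseteq> squarefree_monomials N"
    unfolding keys using B by (auto intro!: subset_monomial_squarefree)
  then have expansion: "expansion N (K_class N ((1 + var 1) ^ n)) = ?q"
    unfolding class_eq by (rule expansion_K_class)
  have card: "card (subset_monomial ` Pow ?B) = 2 ^ card ?B"
  proof -
    have "Pow ?B \<subseteq> Collect finite" by (auto intro: finite_subset[OF _ finite_set_decode])
    then have "inj_on subset_monomial (Pow ?B)"
      by (rule inj_on_subset[OF inj_on_subset_monomial])
    then show ?thesis by (simp add: card_image card_Pow)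
  qed
  have weight: "card ?B = hamming_weight n"
    by (simp add: hamming_weight_def set_decode_def bit_iff_odd)
  show ?thesis
    unfolding expansion eval_at_ones_eq_card_keys keys card weight gould_def by (rule refl)
qed

theorem theorem7:
  fixes n b :: nat and K :: "(bit mpoly set) ring"
  assumes "n > 0"
    and "b = nat \<lfloor>log 2 (real n)\<rfloor> + 2"
    and "K = K_ring b"
  shows "eval_at_ones (expansion b ((\<one>\<^bsub>K\<^esub> \<oplus>\<^bsub>K\<^esub> K_class b (var 1)) [^]\<^bsub>K\<^esub> n)) = int (gould n)"
proof -
  have "n < 2 ^ b"
  proof -
    have "log 2 (real n) < real b"
      using assms(2) by linarith
    then have "real n < 2 powr real b"
      using assms(1) by (simp add: log_less_iff)
    then show ?thesis by (simp add: powr_realpow)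
  qed
  have var: "(var 1 :: bit mpoly) \<in> carrier (poly_ring b)"
    using assms(2) by (intro var_in_carrier) simp
  have "\<one>\<^bsub>K\<^esub> \<oplus>\<^bsub>K\<^esub> K_class b (var 1) = K_class b (1 + var 1)"
    using ring_hom_one[OF K_class_ring_hom[of b, where 'a = bit]]
      ring_hom_add[OF K_class_ring_hom one_in_carrier var] assms(3) by simp
  then have "(\<one>\<^bsub>K\<^esub> \<oplus>\<^bsub>K\<^esub> K_class b (var 1)) [^]\<^bsub>K\<^esub> n = K_class b ((1 + var 1) ^ n)"
    using K_class_power[OF add_in_carrier[OF one_in_carrier var]] assms(3) by simp
  then show ?thesis
    using eval_expansion_power[OF \<open>n < 2 ^ b\<close>] by simp
qed

end
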